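(* Let $r,\nu\in(0,\infty)$ and $p\in(0,1)$. In each of the following two cases the $\mathrm{CMNB}(r,\nu,p)$ distribution is overdispersed: (1) $\nu>0$ and $r<1$; (2) $\nu<1$ and $r\in(0,\infty)$ arbitrary.
   Context: For $r,\nu\in(0,\infty)$ and $p\in(0,1)$, a random variable $X$ follows the COM-negative binomial distribution $\mathrm{CMNB}(r,\nu,p)$ if $$\mathrm{P}(X=k)=\left(\frac{\Gamma(r+k)}{k!\,\Gamma(r)}\right)^{\nu}p^k(1-p)^r\frac{1}{C(r,\nu,p)},\quad k=0,1,2,\ldots,\qquad C(r,\nu,p)=\sum_{i=0}^{\infty}\left(\frac{\Gamma(r+i)}{i!\,\Gamma(r)}\right)^{\nu}p^i(1-p)^r .$$ The distribution of $X$ is overdispersed if $\mathrm{E}[X]<\mathrm{Var}(X)$. *)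

theory Defs
  imports "HOL-Probability.Probability"
begin

(* The common factor (1 - p) powr r of numerator and normalizing constant cancels; it is kept
   because C(r, nu, p) then reduces to 1 for nu = 1, the negative binomial distribution. *)
definition cmnb_term :: "real \<Rightarrow> real \<Rightarrow> real \<Rightarrow> nat \<Rightarrow> real" where
  "cmnb_term r \<nu> p k =
     (Gamma (r + real k) / (fact k * Gamma r)) powr \<nu> * p ^ k * (1 - p) powr r"

definition cmnb_const :: "real \<Rightarrow> real \<Rightarrow> real \<Rightarrow> real" where
  "cmnb_const r \<nu> p = (\<Sum>i. cmnb_term r \<nu> p i)"

definition (in prob_space) CMNB_distributed ::
    "('a \<Rightarrow> nat) \<Rightarrow> real \<Rightarrow> real \<Rightarrow> real \<Rightarrow> bool" where
  "CMNB_distributed X r \<nu> p \<longleftrightarrow>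
     random_variable (count_space UNIV) X \<and>
     (\<forall>k. \<P>(\<omega> in M. X \<omega> = k) = cmnb_term r \<nu> p k / cmnb_const r \<nu> p)"

(* The Bochner integral of a non-integrable function is 0, so the existence of the first two
   moments has to be required explicitly for mean and variance to be meaningful. *)
definition (in prob_space) overdispersed :: "('a \<Rightarrow> real) \<Rightarrow> bool" where
  "overdispersed X \<longleftrightarrow>
     integrable M X \<and> integrable M (\<lambda>\<omega>. (X \<omega>)\<^sup>2) \<and> expectation X < variance X"

lemma cmnb_term_pos:
  assumes "0 < r" "0 < p" "p < 1"
  shows "0 < cmnb_term r \<nu> p k"
proof -
  have "Gamma (r + real k) > 0" "Gamma r > 0"
    using assms by (auto intro!: Gamma_real_pos)
  then have "Gamma (r + real k) / (fact k * Gamma r) > 0" by simp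
  then show ?thesis using assms unfolding cmnb_term_def
    by (intro mult_pos_pos zero_less_power iffD2[OF powr_gt_zero] less_imp_neq[THEN not_sym]) linarith+
qed

lemma cmnb_term_Suc:
  assumes "0 < r" "0 < p" "p < 1"
  shows "cmnb_term r \<nu> p (Suc k) = ((r + real k) / real (Suc k)) powr \<nu> * p * cmnb_term r \<nu> p k"
proof -
  have pos: "Gamma (r + real k) > 0" "Gamma r > 0"
    using assms by (auto intro!: Gamma_real_pos)
  have "r + real k \<notin> \<int>\<^sub>\<le>\<^sub>0"
    using assms by (auto elim!: nonpos_Ints_cases)
  then have G: "Gamma (r + real (Suc k)) = (r + real k) * Gamma (r + real k)"
    using Gamma_plus1[of "r + real k"] by (simp add: add_ac)
  have "Gamma (r + real (Suc k)) / (fact (Suc k) * Gamma r)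
      = ((r + real k) / real (Suc k)) * (Gamma (r + real k) / (fact k * Gamma r))"
    unfolding G by (simp add: field_simps)
  then have "(Gamma (r + real (Suc k)) / (fact (Suc k) * Gamma r)) powr \<nu>
      = ((r + real k) / real (Suc k)) powr \<nu> * (Gamma (r + real k) / (fact k * Gamma r)) powr \<nu>"
    using pos assms by (simp only: powr_mult)
  then show ?thesis
    unfolding cmnb_term_def by simp
qed

lemma summable_cmnb_term:
  assumes "0 < r" "0 < p" "p < 1"
  shows "summable (cmnb_term r \<nu> p)"
proof -
  have "(\<lambda>k. (r + real k) / real (Suc k)) \<longlonglongrightarrow> 1" by real_asymp
  then have "(\<lambda>k. ((r + real k) / real (Suc k)) powr \<nu> * p) \<longlonglongrightarrow> 1 powr \<nu> * p"
    by (intro tendsto_intros) auto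
  then have lim: "(\<lambda>k. ((r + real k) / real (Suc k)) powr \<nu> * p) \<longlonglongrightarrow> p" by simp
  obtain c where c: "p < c" "c < 1" using assms dense by blast
  from order_tendstoD(2)[OF lim c(1)] obtain N
    where N: "\<And>k. k \<ge> N \<Longrightarrow> ((r + real k) / real (Suc k)) powr \<nu> * p < c"
    by (auto simp: eventually_sequentially)
  show ?thesis
  proof (rule summable_ratio_test[OF c(2), of N])
    fix k assume "k \<ge> N"
    then show "norm (cmnb_term r \<nu> p (Suc k)) \<le> c * norm (cmnb_term r \<nu> p k)"
      using N[of k] cmnb_term_pos[OF assms, of \<nu> k] cmnb_term_pos[OF assms, of \<nu> "Suc k"]
        cmnb_term_Suc[OF assms, of \<nu> k]
      by (simp add: mult_right_mono)
  qed
qed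

lemma CMNB_distribution_exists:
  assumes "0 < r" "0 < p" "p < 1"
  shows "\<exists>D :: nat pmf. prob_space.CMNB_distributed (measure_pmf D) (\<lambda>k. k) r \<nu> p"
proof -
  let ?f = "\<lambda>k. cmnb_term r \<nu> p k / cmnb_const r \<nu> p"
  have C: "cmnb_const r \<nu> p > 0"
    unfolding cmnb_const_def
    using suminf_pos[OF summable_cmnb_term[OF assms]] cmnb_term_pos[OF assms] by blast
  have nonneg: "?f k \<ge> 0" for k
    using C cmnb_term_pos[OF assms, of \<nu> k] by simp
  have sums: "?f sums 1"
    using sums_divide[OF summable_sums[OF summable_cmnb_term[OF assms, of \<nu>]], of "cmnb_const r \<nu> p"] C
    unfolding cmnb_const_def by simp
  have "(\<integral>\<^sup>+k. ennreal (?f k) \<partial>count_space UNIV) = (\<Sum>k. ennreal (?f k))"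
    by (rule nn_integral_count_space_nat)
  also have "\<dots> = ennreal (\<Sum>k. ?f k)"
    using sums nonneg by (intro suminf_ennreal2) (auto simp: sums_iff)
  also have "\<dots> = 1" using sums by (simp add: sums_iff)
  finally have tot: "(\<integral>\<^sup>+k. ennreal (?f k) \<partial>count_space UNIV) = 1" .
  have "pmf (embed_pmf ?f) k = ?f k" for k
    by (rule pmf_embed_pmf[OF nonneg tot])
  then have "prob_space.CMNB_distributed (measure_pmf (embed_pmf ?f)) (\<lambda>k. k) r \<nu> p"
    by (simp add: prob_space.CMNB_distributed_def[OF prob_space_measure_pmf] pmf.rep_eq)
  then show ?thesis by blast
qed

end

theory Submission
  imports Defs
begin

text \<open>Put \<open>q k = (k + 1) P(X = k + 1) / P(X = k) = p (k + 1) ((r + k) / (k + 1))\<^sup>\<nu>\<close>. An index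
  shift gives \<open>E[X g(X)] = E[q(X) g(X + 1)]\<close>, hence \<open>E[X] = E[q(X)]\<close>, \<open>E[X (X - 1)] = E[X q(X)]\<close>
  and \<open>Var(X) - E[X] = Cov(X, q(X))\<close>. In both cases \<open>q\<close> is strictly increasing, so that
  this covariance is positive.\<close>

text \<open>The point masses of X are a density of its law with respect to counting measure, because
  measures on a countable space are determined by singletons. Expectations thus become integrals
  over counting measure, and absolute summability turns these into series.\<close>

lemma (in prob_space)
  fixes X :: "'a \<Rightarrow> nat" and g :: "nat \<Rightarrow> real"
  assumes X: "random_variable (count_space UNIV) X"
    and g: "summable (\<lambda>k. \<bar>g k\<bar> * \<P>(\<omega> in M. X \<omega> = k))"
  shows integrable_nat_valued: "integrable M (\<lambda>\<omega>. g (X \<omega>))"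
    and expectation_nat_valued: "expectation (\<lambda>\<omega>. g (X \<omega>)) = (\<Sum>k. g k * \<P>(\<omega> in M. X \<omega> = k))"
proof -
  let ?w = "\<lambda>k. \<P>(\<omega> in M. X \<omega> = k)"
  have "density (count_space UNIV) (\<lambda>k. ennreal (?w k)) = distr M (count_space UNIV) X"
  proof (rule measure_eqI_countable[of _ UNIV])
    fix k
    have "emeasure (distr M (count_space UNIV) X) {k} = emeasure M (X -` {k} \<inter> space M)"
      using X by (simp add: emeasure_distr)
    also have "X -` {k} \<inter> space M = {\<omega> \<in> space M. X \<omega> = k}" by auto
    finally show "emeasure (density (count_space UNIV) (\<lambda>k. ennreal (?w k))) {k}
        = emeasure (distr M (count_space UNIV) X) {k}"
      by (simp add: emeasure_density nn_integral_count_space_indicator[symmetric]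
          emeasure_eq_measure nn_integral_count_space_finite)
  qed auto
  then have D: "distributed M (count_space UNIV) X (\<lambda>k. ennreal (?w k))"
    using X by (simp add: distributed_def)
  have I: "integrable (count_space UNIV) (\<lambda>k. ?w k * g k)"
    using g by (simp add: integrable_count_space_nat_iff abs_mult mult.commute)
  then show "integrable M (\<lambda>\<omega>. g (X \<omega>))"
    using distributed_integrable[OF D, of g] by simp
  have "expectation (\<lambda>\<omega>. g (X \<omega>)) = (\<integral>k. ?w k * g k \<partial>count_space UNIV)"
    using distributed_integral[OF D, of g] by simp
  also have "\<dots> = (\<Sum>k. g k * ?w k)"
    using integral_count_space_nat[OF I] by (simp add: mult.commute)
  finally show "expectation (\<lambda>\<omega>. g (X \<omega>)) = (\<Sum>k. g k * ?w k)" .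
qed

lemma summable_first_moment:
  fixes w :: "nat \<Rightarrow> real"
  assumes "\<And>k. 0 \<le> w k" and "summable (\<lambda>k. (real k)\<^sup>2 * w k)"
  shows "summable (\<lambda>k. real k * w k)"
proof (rule summable_comparison_test'[OF assms(2), of 0])
  fix k :: nat
  have "real k \<le> (real k)\<^sup>2" by (cases k) (auto simp: power2_eq_square)
  then show "norm (real k * w k) \<le> (real k)\<^sup>2 * w k"
    using assms(1)[of k] by (simp add: mult_right_mono)
qed

lemma mean_less_variance_if_strict_mono_ratio:
  fixes w q :: "nat \<Rightarrow> real"
  assumes pos: "\<And>k. 0 < w k" and total: "w sums 1"
    and moment2: "summable (\<lambda>k. (real k)\<^sup>2 * w k)"
    and ratio: "\<And>k. real (Suc k) * w (Suc k) = q k * w k"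
    and mono: "strict_mono q"
  shows "(\<Sum>k. real k * w k) < (\<Sum>k. (real k)\<^sup>2 * w k) - (\<Sum>k. real k * w k)\<^sup>2"
proof -
  define \<mu> where "\<mu> = (\<Sum>k. real k * w k)"
  define S where "S = (\<Sum>k. (real k)\<^sup>2 * w k)"
  have "summable (\<lambda>k. real k * w k)"
    using summable_first_moment[OF _ moment2] pos by (simp add: less_imp_le)
  then have m1: "(\<lambda>k. real k * w k) sums \<mu>"
    unfolding \<mu>_def by (rule summable_sums)
  have m2: "(\<lambda>k. (real k)\<^sup>2 * w k) sums S"
    unfolding S_def using moment2 by (rule summable_sums)
  \<comment> \<open>The index shift loses nothing: the term at k = 0 vanishes. The same holds for
    the second factorial moment below.\<close>
  have "(\<lambda>k. real (Suc k) * w (Suc k)) sums \<mu>"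
    using m1 by (subst sums_Suc_iff) simp
  then have q1: "(\<lambda>k. q k * w k) sums \<mu>"
    by (simp only: ratio)
  \<comment> \<open>\<open>S - \<mu>\<close> is E[X (X - 1)]. After the shift its weight (k + 1)^2 -
    (k + 1) = k (k + 1) contains the factor k + 1 that \<open>ratio\<close> absorbs into
    \<open>q k\<close>.\<close>
  have "(\<lambda>k. (real k)\<^sup>2 * w k - real k * w k) sums (S - \<mu>)"
    by (rule sums_diff[OF m2 m1])
  then have "(\<lambda>k. (real (Suc k))\<^sup>2 * w (Suc k) - real (Suc k) * w (Suc k)) sums (S - \<mu>)"
    by (subst sums_Suc_iff[of "\<lambda>k. (real k)\<^sup>2 * w k - real k * w k"]) simp
  moreover have "(real (Suc k))\<^sup>2 * w (Suc k) - real (Suc k) * w (Suc k) = real k * (q k * w k)" for k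
    unfolding ratio[symmetric] by (simp add: algebra_simps power2_eq_square)
  ultimately have q2: "(\<lambda>k. real k * (q k * w k)) sums (S - \<mu>)" by simp
  have "0 \<le> \<mu>"
    using sums_le[OF _ sums_zero m1] pos by (simp add: less_imp_le)
  \<comment> \<open>The sign of k - \<open>\<mu>\<close> changes at \<open>n\<close>: it is positive
    for every natural k > n and nonpositive for k < n, exactly as \<open>q\<close> passes the value
    \<open>q n\<close>.\<close>
  define n where "n = nat \<lfloor>\<mu>\<rfloor>"
  have n: "real n \<le> \<mu>" "\<mu> < real n + 1"
    using \<open>0 \<le> \<mu>\<close> unfolding n_def by linarith+
  \<comment> \<open>\<open>q n\<close> replaces the mean of \<open>q\<close>, which makes every term of the covariance nonnegative.\<close>
  let ?t = "\<lambda>k. (real k - \<mu>) * (q k - q n) * w k"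
  have "?t sums (((S - \<mu>) - q n * \<mu>) - (\<mu> * \<mu> - \<mu> * q n * 1))"
  proof -
    have "?t = (\<lambda>k. (real k * (q k * w k) - q n * (real k * w k)) - (\<mu> * (q k * w k) - \<mu> * q n * w k))"
      by (simp add: algebra_simps)
    then show ?thesis
      by (simp only:) (intro sums_diff sums_mult q1 q2 m1 total)
  qed
  \<comment> \<open>The terms with \<open>q n\<close> cancel since the deviations k -
    \<open>\<mu>\<close> have mean zero, so the sum is still the covariance.\<close>
  then have sums: "?t sums (S - \<mu> - \<mu>\<^sup>2)"
    by (simp add: power2_eq_square algebra_simps)
  have gt: "0 < ?t k" if "n < k" for k
  proof -
    have "real n + 1 \<le> real k" using that by linarith
    then have "0 < real k - \<mu>" using n by linarith
    moreover have "0 < q k - q n" using strict_monoD[OF mono that] by simp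
    ultimately show ?thesis using pos by simp
  qed
  have ge: "0 \<le> ?t k" for k
  proof (cases k n rule: linorder_cases)
    case less
    then have "real k - \<mu> \<le> 0" "q k - q n \<le> 0"
      using n strict_monoD[OF mono less] by simp_all
    then show ?thesis using less_imp_le[OF pos] by (intro mult_nonneg_nonneg mult_nonpos_nonpos)
  qed (use gt[of k] in auto)
  \<comment> \<open>A single positive term makes the inequality strict; \<open>Suc n\<close> is the
    first index above \<open>n\<close>.\<close>
  have "0 < suminf ?t"
    using suminf_pos2[OF sums_summable[OF sums] ge gt[of "Suc n"]] by simp
  then show ?thesis
    using sums by (simp add: sums_iff \<mu>_def S_def)
qed

text \<open>A polynomial weight does not change the limit p < 1 of successive ratios, so the ratio
  test still applies.\<close>

lemma summable_power2_cmnb_term: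
  assumes "0 < r" "0 < p" "p < 1"
  shows "summable (\<lambda>k. (real k)\<^sup>2 * cmnb_term r \<nu> p k)"
proof -
  \<comment> \<open>The weight (k + 1)^2 dominates k^2 and never vanishes, so the quotient
    \<open>?\<rho> k\<close> of successive terms makes sense at k = 0 too.\<close>
  let ?b = "\<lambda>k. (real (Suc k))\<^sup>2 * cmnb_term r \<nu> p k"
  let ?\<rho> = "\<lambda>k. ((real k + 2) / (real k + 1))\<^sup>2 * (((r + real k) / real (Suc k)) powr \<nu> * p)"
  note pos = cmnb_term_pos[OF assms, of \<nu>]
  have "(\<lambda>k. (r + real k) / real (Suc k)) \<longlonglongrightarrow> 1" by real_asymp
  moreover have "(\<lambda>k. (real k + 2) / (real k + 1)) \<longlonglongrightarrow> 1" by real_asymp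
  ultimately have "?\<rho> \<longlonglongrightarrow> 1\<^sup>2 * (1 powr \<nu> * p)"
    by (intro tendsto_intros) auto
  then have lim: "?\<rho> \<longlonglongrightarrow> p" by simp
  obtain c where c: "p < c" "c < 1" using assms dense by blast
  from order_tendstoD(2)[OF lim c(1)] obtain N where N: "\<And>k. k \<ge> N \<Longrightarrow> ?\<rho> k < c"
    by (auto simp: eventually_sequentially)
  have "summable ?b"
  proof (rule summable_ratio_test[OF c(2), of N])
    fix k assume "k \<ge> N"
    have "?b (Suc k) = ?\<rho> k * ?b k"
      by (simp add: cmnb_term_Suc[OF assms] power_divide add_ac)
    also have "\<dots> \<le> c * ?b k"
      using N[OF \<open>k \<ge> N\<close>] pos[of k] by (intro mult_right_mono) auto
    finally show "norm (?b (Suc k)) \<le> c * norm (?b k)"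
      using pos[of k] pos[of "Suc k"] by simp
  qed
  then show ?thesis
  proof (rule summable_comparison_test'[of _ 0])
    fix k :: nat
    show "norm ((real k)\<^sup>2 * cmnb_term r \<nu> p k) \<le> ?b k"
      using pos[of k] by (simp add: mult_right_mono power_mono)
  qed
qed

text \<open>In each case \<open>?q\<close> is a product of two positive factors, the first strictly
  increasing and the second nondecreasing; only the factorization differs.\<close>

lemma strict_mono_cmnb_ratio:
  fixes r \<nu> p :: real
  assumes "0 < r" "0 < \<nu>" "0 < p" and "r < 1 \<or> \<nu> < 1"
  shows "strict_mono (\<lambda>k. p * (real (Suc k) * ((r + real k) / real (Suc k)) powr \<nu>))"
    (is "strict_mono (\<lambda>k. p * ?q k)")
proof -
  have "?q k < ?q (Suc k)" for k
    using assms(4)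
  proof
    assume "r < 1"
    \<comment> \<open>The quotient equals 1 - (1 - r) / (k + 1), which grows with k when r <
      1.\<close>
    have "(r + real k) / real (Suc k) \<le> (r + real (Suc k)) / real (Suc (Suc k))"
      using \<open>r < 1\<close> by (simp add: divide_simps) (simp add: algebra_simps)
    then have "((r + real k) / real (Suc k)) powr \<nu>
        \<le> ((r + real (Suc k)) / real (Suc (Suc k))) powr \<nu>"
      using assms by (intro powr_mono2) auto
    moreover have "0 < ((r + real k) / real (Suc k)) powr \<nu>"
      using assms by (auto simp: add_pos_nonneg)
    ultimately show ?thesis
      by (intro mult_less_le_imp_less) auto
  next
    assume "\<nu> < 1"
    \<comment> \<open>Here the quotient may decrease, as it does for r > 1. Merging its denominator
      with the factor j + 1 leaves the positive exponent 1 - \<open>\<nu>\<close>.\<close>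
    have q: "?q j = real (Suc j) powr (1 - \<nu>) * (r + real j) powr \<nu>" for j
      using assms by (simp add: powr_divide powr_diff)
    have "real (Suc k) powr (1 - \<nu>) < real (Suc (Suc k)) powr (1 - \<nu>)"
      using \<open>\<nu> < 1\<close> by (intro powr_less_mono2) auto
    moreover have "(r + real k) powr \<nu> \<le> (r + real (Suc k)) powr \<nu>"
      using assms by (intro powr_mono2) auto
    moreover have "0 < (r + real k) powr \<nu>"
      using assms by simp
    ultimately show ?thesis
      unfolding q by (intro mult_less_le_imp_less) auto
  qed
  then show ?thesis
    using \<open>0 < p\<close> by (intro iffD2[OF strict_mono_Suc_iff]) (auto intro: mult_strict_left_mono)
qed

theorem corollary2p3:
  fixes M :: "'a measure" and X :: "'a \<Rightarrow> nat" and r \<nu> p :: real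
  assumes "prob_space M"
    and "0 < r" and "0 < \<nu>" and "0 < p" and "p < 1"
    and "prob_space.CMNB_distributed M X r \<nu> p"
    and "(0 < \<nu> \<and> r < 1) \<or> (\<nu> < 1 \<and> 0 < r)"
  shows "prob_space.overdispersed M (\<lambda>\<omega>. real (X \<omega>))"
proof -
  interpret prob_space M by fact
  define w where "w = (\<lambda>k. \<P>(\<omega> in M. X \<omega> = k))"
  define C where "C = cmnb_const r \<nu> p"
  have X: "random_variable (count_space UNIV) X" and w: "w k = cmnb_term r \<nu> p k / C" for k
    using assms(6) by (simp_all add: CMNB_distributed_def w_def C_def)
  note par = \<open>0 < r\<close> \<open>0 < p\<close> \<open>p < 1\<close>
  note a_pos = cmnb_term_pos[OF par, of \<nu>]
  have C: "0 < C"
    unfolding C_def cmnb_const_def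
    using suminf_pos[OF summable_cmnb_term[OF par]] a_pos by blast
  have w_pos: "0 < w k" for k
    using C a_pos by (simp add: w)
  have total: "w sums 1"
    using sums_divide[OF summable_sums[OF summable_cmnb_term[OF par, of \<nu>]], of C] C
    by (simp add: w[abs_def] C_def cmnb_const_def)
  have moment2: "summable (\<lambda>k. (real k)\<^sup>2 * w k)"
    using summable_divide[OF summable_power2_cmnb_term[OF par, of \<nu>], of C] by (simp add: w)
  \<comment> \<open>The normalizing constant \<open>C\<close> divides both sides, so the recursion
    of \<open>cmnb_term\<close> carries over to the probabilities.\<close>
  have ratio: "real (Suc k) * w (Suc k)
      = p * (real (Suc k) * ((r + real k) / real (Suc k)) powr \<nu>) * w k" for k
    by (simp only: w cmnb_term_Suc[OF par]) (simp add: mult_ac)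
  have "strict_mono (\<lambda>k. p * (real (Suc k) * ((r + real k) / real (Suc k)) powr \<nu>))"
    using assms by (intro strict_mono_cmnb_ratio) auto
  note less = mean_less_variance_if_strict_mono_ratio[OF w_pos total moment2 ratio this]
  have E2: "integrable M (\<lambda>\<omega>. (real (X \<omega>))\<^sup>2)"
      "expectation (\<lambda>\<omega>. (real (X \<omega>))\<^sup>2) = (\<Sum>k. (real k)\<^sup>2 * w k)"
    using integrable_nat_valued[OF X, of "\<lambda>k. (real k)\<^sup>2"]
      expectation_nat_valued[OF X, of "\<lambda>k. (real k)\<^sup>2"] moment2
    by (simp_all add: w_def)
  have "summable (\<lambda>k. real k * w k)"
    using summable_first_moment[OF _ moment2] w_pos by (simp add: less_imp_le)
  then have E1: "integrable M (\<lambda>\<omega>. real (X \<omega>))"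
      "expectation (\<lambda>\<omega>. real (X \<omega>)) = (\<Sum>k. real k * w k)"
    using integrable_nat_valued[OF X, of real] expectation_nat_valued[OF X, of real]
    by (simp_all add: w_def)
  \<comment> \<open>With both moments finite, \<open>variance_eq\<close> gives Var(X) = E[X^2] -
    E[X]^2, the form in which \<open>less\<close> is stated.\<close>
  show ?thesis
    using less E1 E2(1) variance_eq[OF E1(1) E2(1)] unfolding overdispersed_def E2(2) E1(2)
    by simp
qed

end
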